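(* Let $X, Y$ be nonempty sets, let $\mathcal{A}$ be a nonempty set of binary operations on $X$ and $\mathcal{B}$ a nonempty set of binary operations on $Y$. Let $G$ and $H$ be groups acting on $X$ and on $Y$, respectively, such that for all $\alpha \in \mathcal{A}$, $\beta \in \mathcal{B}$, $g \in G$, $h \in H$, $x, x' \in X$, $y, y' \in Y$ one has $$\alpha(gx, gx') = g\,\alpha(x,x'), \qquad \beta(hy, hy') = h\,\beta(y,y').$$ Consider the induced action of $G \times H$ on the generalized tensor product $X \bigotimes_{\mathcal{A},\mathcal{B}} Y$. Then for every $w \in X \bigotimes_{\mathcal{A},\mathcal{B}} Y$ and every $(g,h) \in G \times H$, $$w \text{ is entangled} \iff (g,h)w \text{ is entangled},$$ and therefore $$w \text{ is not entangled} \iff (g,h)w \text{ is not entangled}.$$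
   Context: Generalized tensor product. Let $Z$ be the set of all finite sequences $(x_1,y_1),\dots,(x_n,y_n)$ with $n \ge 1$, $x_i \in X$, $y_i \in Y$, and let $\gamma$ denote concatenation of sequences, so that such a sequence is written $(x_1,y_1)\,\gamma\,\cdots\,\gamma\,(x_n,y_n)$; in particular $X \times Y \subseteq Z$. Define the equivalence relation $\approx_{\mathcal{A},\mathcal{B}}$ on $Z$: two sequences are equivalent iff they are identical or each can be obtained from the other by a finite number of applications of the following operations: (1) permute the pairs $(x_i,y_i)$ within the sequence; (2) replace $(x_1,y_1)\,\gamma\,(x_1',y_1)\,\gamma\,(x_2,y_2)\,\gamma\cdots\gamma\,(x_n,y_n)$ by $(\alpha(x_1,x_1'),y_1)\,\gamma\,(x_2,y_2)\,\gamma\cdots\gamma\,(x_n,y_n)$, or vice versa, for some $\alpha\in\mathcal{A}$; (3) replace $(x_1,y_1)\,\gamma\,(x_1,y_1')\,\gamma\,(x_2,y_2)\,\gamma\cdots\gamma\,(x_n,y_n)$ by $(x_1,\beta(y_1,y_1'))\,\gamma\,(x_2,y_2)\,\gamma\cdots\gamma\,(x_n,y_n)$, or vice versa, for some $\beta\in\mathcal{B}$. (In (2) and (3), $n\ge 1$, so the remaining part $(x_2,y_2)\,\gamma\cdots\gamma\,(x_n,y_n)$ may be empty.) Then $X \bigotimes_{\mathcal{A},\mathcal{B}} Y := Z/\approx_{\mathcal{A},\mathcal{B}}$, and $x \bigotimes_{\mathcal{A},\mathcal{B}} y$ denotes the class of the length-one sequence $(x,y)$. The operation $\gamma$ passes to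 the quotient, and every element of the quotient has the form $x_1 \bigotimes_{\mathcal{A},\mathcal{B}} y_1\,\gamma\cdots\gamma\,x_n\bigotimes_{\mathcal{A},\mathcal{B}} y_n$. Entanglement. An element $w \in X \bigotimes_{\mathcal{A},\mathcal{B}} Y$ is called entangled iff it is not of the form $w = x \bigotimes_{\mathcal{A},\mathcal{B}} y$ for any $x\in X$, $y \in Y$. Induced action. Under the stated compatibility of the group actions with $\mathcal{A}$ and $\mathcal{B}$, the action of $G\times H$ on $Z$ given by $(g,h)\big((x_1,y_1)\,\gamma\cdots\gamma\,(x_n,y_n)\big) = (gx_1,hy_1)\,\gamma\cdots\gamma\,(gx_n,hy_n)$ respects $\approx_{\mathcal{A},\mathcal{B}}$, and the induced action on $X \bigotimes_{\mathcal{A},\mathcal{B}} Y$ is $$(g,h)\big(x_1 \textstyle\bigotimes_{\mathcal{A},\mathcal{B}} y_1\,\gamma\cdots\gamma\,x_n\bigotimes_{\mathcal{A},\mathcal{B}} y_n\big) = (gx_1) \bigotimes_{\mathcal{A},\mathcal{B}} (hy_1)\,\gamma\cdots\gamma\,(gx_n)\bigotimes_{\mathcal{A},\mathcal{B}} (hy_n).$$ *)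

theory Defs
  imports "HOL-Algebra.Group_Action" "HOL-Library.Multiset"
begin

text \<open>Finite nonempty sequences of pairs; the operation \<open>\<gamma>\<close> is list concatenation.\<close>

definition gtp_seqs :: "'a set \<Rightarrow> 'b set \<Rightarrow> ('a \<times> 'b) list set" where
  "gtp_seqs X Y = {s. s \<noteq> [] \<and> set s \<subseteq> X \<times> Y}"

text \<open>A set of binary operations on a carrier; values outside the carrier are irrelevant.\<close>

definition binary_ops_on :: "'a set \<Rightarrow> ('a \<Rightarrow> 'a \<Rightarrow> 'a) set \<Rightarrow> bool" where
  "binary_ops_on X A \<longleftrightarrow> (\<forall>\<alpha>\<in>A. \<forall>x\<in>X. \<forall>x'\<in>X. \<alpha> x x' \<in> X)"

text \<open>One application of an operation. The rules act at the front of the sequence, and the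
  remaining part \<open>r\<close> may be empty.\<close>

inductive gtp_step ::
  "'a set \<Rightarrow> 'b set \<Rightarrow> ('a \<Rightarrow> 'a \<Rightarrow> 'a) set \<Rightarrow> ('b \<Rightarrow> 'b \<Rightarrow> 'b) set
    \<Rightarrow> ('a \<times> 'b) list \<Rightarrow> ('a \<times> 'b) list \<Rightarrow> bool"
  for X :: "'a set" and Y :: "'b set" and A B
where
  permute: "\<lbrakk>s \<in> gtp_seqs X Y; mset t = mset s\<rbrakk> \<Longrightarrow> gtp_step X Y A B s t"
| merge_left: "\<lbrakk>\<alpha> \<in> A; x \<in> X; x' \<in> X; y \<in> Y; set r \<subseteq> X \<times> Y\<rbrakk>
    \<Longrightarrow> gtp_step X Y A B ((x, y) # (x', y) # r) ((\<alpha> x x', y) # r)"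
| split_left: "\<lbrakk>\<alpha> \<in> A; x \<in> X; x' \<in> X; y \<in> Y; set r \<subseteq> X \<times> Y\<rbrakk>
    \<Longrightarrow> gtp_step X Y A B ((\<alpha> x x', y) # r) ((x, y) # (x', y) # r)"
| merge_right: "\<lbrakk>\<beta> \<in> B; x \<in> X; y \<in> Y; y' \<in> Y; set r \<subseteq> X \<times> Y\<rbrakk>
    \<Longrightarrow> gtp_step X Y A B ((x, y) # (x, y') # r) ((x, \<beta> y y') # r)"
| split_right: "\<lbrakk>\<beta> \<in> B; x \<in> X; y \<in> Y; y' \<in> Y; set r \<subseteq> X \<times> Y\<rbrakk>
    \<Longrightarrow> gtp_step X Y A B ((x, \<beta> y y') # r) ((x, y) # (x, y') # r)"

definition gtp_rel ::
  "'a set \<Rightarrow> 'b set \<Rightarrow> ('a \<Rightarrow> 'a \<Rightarrow> 'a) set \<Rightarrow> ('b \<Rightarrow> 'b \<Rightarrow> 'b) set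
    \<Rightarrow> (('a \<times> 'b) list \<times> ('a \<times> 'b) list) set" where
  "gtp_rel X Y A B = {(s, t). s \<in> gtp_seqs X Y \<and> t \<in> gtp_seqs X Y \<and>
     (s = t \<or> ((gtp_step X Y A B)\<^sup>*\<^sup>* s t \<and> (gtp_step X Y A B)\<^sup>*\<^sup>* t s))}"

definition gtp ::
  "'a set \<Rightarrow> 'b set \<Rightarrow> ('a \<Rightarrow> 'a \<Rightarrow> 'a) set \<Rightarrow> ('b \<Rightarrow> 'b \<Rightarrow> 'b) set
    \<Rightarrow> ('a \<times> 'b) list set set" where
  "gtp X Y A B = gtp_seqs X Y // gtp_rel X Y A B"

definition pure_tensor ::
  "'a set \<Rightarrow> 'b set \<Rightarrow> ('a \<Rightarrow> 'a \<Rightarrow> 'a) set \<Rightarrow> ('b \<Rightarrow> 'b \<Rightarrow> 'b) set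
    \<Rightarrow> 'a \<Rightarrow> 'b \<Rightarrow> ('a \<times> 'b) list set" where
  "pure_tensor X Y A B x y = gtp_rel X Y A B `` {[(x, y)]}"

text \<open>Meant for \<open>w \<in> gtp X Y A B\<close>.\<close>

definition entangled ::
  "'a set \<Rightarrow> 'b set \<Rightarrow> ('a \<Rightarrow> 'a \<Rightarrow> 'a) set \<Rightarrow> ('b \<Rightarrow> 'b \<Rightarrow> 'b) set
    \<Rightarrow> ('a \<times> 'b) list set \<Rightarrow> bool" where
  "entangled X Y A B w \<longleftrightarrow> \<not> (\<exists>x\<in>X. \<exists>y\<in>Y. w = pure_tensor X Y A B x y)"

definition seq_act ::
  "('g \<Rightarrow> 'a \<Rightarrow> 'a) \<Rightarrow> ('h \<Rightarrow> 'b \<Rightarrow> 'b) \<Rightarrow> 'g \<times> 'h \<Rightarrow> ('a \<times> 'b) list \<Rightarrow> ('a \<times> 'b) list" where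
  "seq_act \<phi> \<psi> gh s = map (\<lambda>(x, y). (\<phi> (fst gh) x, \<psi> (snd gh) y)) s"

text \<open>The action induced on classes, in the usual form of an operation lifted to a quotient: the
  union runs over the representatives of \<open>w\<close>, and \<open>gtp_act_class\<close> below shows that they all
  contribute the same class. The restriction makes the values extensional, as \<open>group_action\<close>
  requires.\<close>

definition gtp_act ::
  "'a set \<Rightarrow> 'b set \<Rightarrow> ('a \<Rightarrow> 'a \<Rightarrow> 'a) set \<Rightarrow> ('b \<Rightarrow> 'b \<Rightarrow> 'b) set
    \<Rightarrow> ('g \<Rightarrow> 'a \<Rightarrow> 'a) \<Rightarrow> ('h \<Rightarrow> 'b \<Rightarrow> 'b) \<Rightarrow> 'g \<times> 'h
    \<Rightarrow> ('a \<times> 'b) list set \<Rightarrow> ('a \<times> 'b) list set" where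
  "gtp_act X Y A B \<phi> \<psi> gh =
     (\<lambda>w\<in>gtp X Y A B. \<Union>s\<in>w. gtp_rel X Y A B `` {seq_act \<phi> \<psi> gh s})"

definition ops_equivariant ::
  "('g, 'm) monoid_scheme \<Rightarrow> 'a set \<Rightarrow> ('a \<Rightarrow> 'a \<Rightarrow> 'a) set \<Rightarrow> ('g \<Rightarrow> 'a \<Rightarrow> 'a) \<Rightarrow> bool" where
  "ops_equivariant G X A \<phi> \<longleftrightarrow>
     (\<forall>\<alpha>\<in>A. \<forall>g\<in>carrier G. \<forall>x\<in>X. \<forall>x'\<in>X. \<alpha> (\<phi> g x) (\<phi> g x') = \<phi> g (\<alpha> x x'))"

lemma equiv_gtp_rel: "equiv (gtp_seqs X Y) (gtp_rel X Y A B)"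
  by (rule equivI) (auto simp: gtp_rel_def refl_on_def sym_def trans_def)

context
  fixes X :: "'a set" and Y :: "'b set" and A B
    and G :: "('g, 'm) monoid_scheme" and H :: "('h, 'n) monoid_scheme" and \<phi> \<psi>
  assumes actG: "group_action G X \<phi>" and actH: "group_action H Y \<psi>"
    and eqvG: "ops_equivariant G X A \<phi>" and eqvH: "ops_equivariant H Y B \<psi>"
begin

lemma seq_act_in_seqs:
  assumes "g \<in> carrier G" "h \<in> carrier H" "s \<in> gtp_seqs X Y"
  shows "seq_act \<phi> \<psi> (g, h) s \<in> gtp_seqs X Y"
  using assms group_action.element_image[OF actG] group_action.element_image[OF actH]
  by (fastforce simp: seq_act_def gtp_seqs_def)

lemma gtp_step_seq_act:
  assumes g: "g \<in> carrier G" and h: "h \<in> carrier H" and "gtp_step X Y A B s t"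
  shows "gtp_step X Y A B (seq_act \<phi> \<psi> (g, h) s) (seq_act \<phi> \<psi> (g, h) t)"
proof -
  have G: "\<phi> g x \<in> X" if "x \<in> X" for x
    using group_action.element_image[OF actG g that] by blast
  have H: "\<psi> h y \<in> Y" if "y \<in> Y" for y
    using group_action.element_image[OF actH h that] by blast
  have R: "(\<lambda>(x, y). (\<phi> g x, \<psi> h y)) ` set r \<subseteq> X \<times> Y" if "set r \<subseteq> X \<times> Y" for r
    using that G H by auto
  show ?thesis
    using assms(3)
  proof cases
    case permute
    then show ?thesis
      using seq_act_in_seqs[OF g h] by (auto intro!: gtp_step.permute simp: seq_act_def)
  next
    case (merge_left \<alpha> x x' y r)
    moreover have "\<phi> g (\<alpha> x x') = \<alpha> (\<phi> g x) (\<phi> g x')"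
      using eqvG g merge_left by (simp add: ops_equivariant_def)
    ultimately show ?thesis
      by (simp add: seq_act_def gtp_step.merge_left G H R)
  next
    case (split_left \<alpha> x x' y r)
    moreover have "\<phi> g (\<alpha> x x') = \<alpha> (\<phi> g x) (\<phi> g x')"
      using eqvG g split_left by (simp add: ops_equivariant_def)
    ultimately show ?thesis
      by (simp add: seq_act_def gtp_step.split_left G H R)
  next
    case (merge_right \<beta> x y y' r)
    moreover have "\<psi> h (\<beta> y y') = \<beta> (\<psi> h y) (\<psi> h y')"
      using eqvH h merge_right by (simp add: ops_equivariant_def)
    ultimately show ?thesis
      by (simp add: seq_act_def gtp_step.merge_right G H R)
  next
    case (split_right \<beta> x y y' r)
    moreover have "\<psi> h (\<beta> y y') = \<beta> (\<psi> h y) (\<psi> h y')"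
      using eqvH h split_right by (simp add: ops_equivariant_def)
    ultimately show ?thesis
      by (simp add: seq_act_def gtp_step.split_right G H R)
  qed
qed

lemma gtp_rel_seq_act:
  assumes g: "g \<in> carrier G" and h: "h \<in> carrier H" and st: "(s, t) \<in> gtp_rel X Y A B"
  shows "(seq_act \<phi> \<psi> (g, h) s, seq_act \<phi> \<psi> (g, h) t) \<in> gtp_rel X Y A B"
proof -
  have "(gtp_step X Y A B)\<^sup>*\<^sup>* (seq_act \<phi> \<psi> (g, h) u) (seq_act \<phi> \<psi> (g, h) v)"
    if "(gtp_step X Y A B)\<^sup>*\<^sup>* u v" for u v
    using that
    by (induction rule: rtranclp_induct)
      (auto intro: rtranclp.rtrancl_into_rtrancl gtp_step_seq_act[OF g h])
  then show ?thesis
    using st seq_act_in_seqs[OF g h] by (auto simp: gtp_rel_def)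
qed

lemma gtp_act_class:
  assumes g: "g \<in> carrier G" and h: "h \<in> carrier H" and s: "s \<in> gtp_seqs X Y"
  shows "gtp_act X Y A B \<phi> \<psi> (g, h) (gtp_rel X Y A B `` {s})
    = gtp_rel X Y A B `` {seq_act \<phi> \<psi> (g, h) s}"
proof -
  have "(\<lambda>s. gtp_rel X Y A B `` {seq_act \<phi> \<psi> (g, h) s}) respects gtp_rel X Y A B"
    by (rule congruentI) (metis gtp_rel_seq_act[OF g h] equiv_class_eq[OF equiv_gtp_rel])
  then show ?thesis
    using UN_equiv_class[OF equiv_gtp_rel _ s] s
    by (simp add: gtp_act_def gtp_def quotientI)
qed

lemma seq_act_mult:
  assumes "g \<in> carrier G" "h \<in> carrier H" "g' \<in> carrier G" "h' \<in> carrier H" "s \<in> gtp_seqs X Y"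
  shows "seq_act \<phi> \<psi> (g \<otimes>\<^bsub>G\<^esub> g', h \<otimes>\<^bsub>H\<^esub> h') s
    = seq_act \<phi> \<psi> (g, h) (seq_act \<phi> \<psi> (g', h') s)"
  using assms group_action.composition_rule[OF actG] group_action.composition_rule[OF actH]
  by (auto simp: seq_act_def gtp_seqs_def)

lemma seq_act_one:
  assumes "s \<in> gtp_seqs X Y"
  shows "seq_act \<phi> \<psi> (\<one>\<^bsub>G\<^esub>, \<one>\<^bsub>H\<^esub>) s = s"
proof -
  have "\<phi> \<one>\<^bsub>G\<^esub> x = x" if "x \<in> X" for x
    using group_action.id_eq_one[OF actG] that by (metis restrict_apply')
  moreover have "\<psi> \<one>\<^bsub>H\<^esub> y = y" if "y \<in> Y" for y
    using group_action.id_eq_one[OF actH] that by (metis restrict_apply')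
  ultimately show ?thesis
    using assms by (auto simp: seq_act_def gtp_seqs_def intro!: map_idI)
qed

theorem group_action_gtp_act:
  "group_action (G \<times>\<times> H) (gtp X Y A B) (gtp_act X Y A B \<phi> \<psi>)"
proof -
  let ?Q = "gtp X Y A B" and ?a = "gtp_act X Y A B \<phi> \<psi>"
  have gG: "group G" and gH: "group H"
    using actG actH by (auto simp: group_action_def group_hom_def)
  have cls: "\<exists>s\<in>gtp_seqs X Y. w = gtp_rel X Y A B `` {s}" if "w \<in> ?Q" for w
    using that by (auto simp: gtp_def elim!: quotientE)
  have closed: "?a (g, h) w \<in> ?Q" if "g \<in> carrier G" "h \<in> carrier H" "w \<in> ?Q" for g h w
    using cls[OF that(3)] gtp_act_class[OF that(1,2)] seq_act_in_seqs[OF that(1,2)]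
    by (auto simp: gtp_def intro!: quotientI)
  have mult: "?a (g \<otimes>\<^bsub>G\<^esub> g', h \<otimes>\<^bsub>H\<^esub> h') w = ?a (g, h) (?a (g', h') w)"
    if "g \<in> carrier G" "h \<in> carrier H" "g' \<in> carrier G" "h' \<in> carrier H" "w \<in> ?Q" for g h g' h' w
    using cls[OF that(5)] that gG gH
    by (auto simp: gtp_act_class seq_act_mult seq_act_in_seqs group.is_monoid monoid.m_closed)
  have one: "?a (\<one>\<^bsub>G\<^esub>, \<one>\<^bsub>H\<^esub>) w = w" if "w \<in> ?Q" for w
    using cls[OF that] gG gH
    by (auto simp: gtp_act_class seq_act_one group.is_monoid monoid.one_closed)
  have bij: "?a (g, h) \<in> Bij ?Q" if g: "g \<in> carrier G" and h: "h \<in> carrier H" for g h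
  proof -
    have inv: "inv\<^bsub>G\<^esub> g \<in> carrier G" "inv\<^bsub>H\<^esub> h \<in> carrier H"
      using g h gG gH by simp_all
    have "?a (inv\<^bsub>G\<^esub> g, inv\<^bsub>H\<^esub> h) (?a (g, h) w) = w"
      and "?a (g, h) (?a (inv\<^bsub>G\<^esub> g, inv\<^bsub>H\<^esub> h) w) = w" if "w \<in> ?Q" for w
      using mult[OF inv g h that] mult[OF g h inv that] one[OF that] g h gG gH
      by (simp_all add: group.l_inv group.r_inv)
    then have "bij_betw (?a (g, h)) ?Q ?Q"
      using closed g h inv by (intro bij_betw_byWitness[where f' = "?a (inv\<^bsub>G\<^esub> g, inv\<^bsub>H\<^esub> h)"]) auto
    then show ?thesis
      by (simp add: Bij_def gtp_act_def)
  qed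
  have "?a \<in> hom (G \<times>\<times> H) (BijGroup ?Q)"
  proof (rule homI)
    fix p assume "p \<in> carrier (G \<times>\<times> H)"
    then show "?a p \<in> carrier (BijGroup ?Q)"
      using bij by (auto simp: DirProd_def BijGroup_def)
  next
    fix p q assume "p \<in> carrier (G \<times>\<times> H)" "q \<in> carrier (G \<times>\<times> H)"
    then obtain g h g' h' where pq: "p = (g, h)" "q = (g', h')" "g \<in> carrier G" "h \<in> carrier H"
      "g' \<in> carrier G" "h' \<in> carrier H"
      by (auto simp: DirProd_def)
    then have "?a (g \<otimes>\<^bsub>G\<^esub> g', h \<otimes>\<^bsub>H\<^esub> h') = compose ?Q (?a (g, h)) (?a (g', h'))"
      by (intro extensionalityI[where A = ?Q])
        (auto simp: mult compose_def, auto simp: gtp_act_def)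
    then show "?a (p \<otimes>\<^bsub>G \<times>\<times> H\<^esub> q) = ?a p \<otimes>\<^bsub>BijGroup ?Q\<^esub> ?a q"
      using pq bij by (simp add: BijGroup_def)
  qed
  then show ?thesis
    using DirProd_group[OF gG gH] group_BijGroup
    by (simp add: group_action_def group_hom_def group_hom_axioms_def)
qed

end

end

theory Submission
  imports Defs
begin

text \<open>Since \<open>(g, h)\<close> sends \<open>x \<Otimes> y\<close> to \<open>g x \<Otimes> h y\<close>, the action maps product elements to product
  elements; applying this to the inverse of \<open>(g, h)\<close> gives the converse.\<close>

lemma gtp_act_pure_tensor:
  assumes "group_action G X \<phi>" "group_action H Y \<psi>"
    and "ops_equivariant G X A \<phi>" "ops_equivariant H Y B \<psi>"
    and "g \<in> carrier G" "h \<in> carrier H" "x \<in> X" "y \<in> Y"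
  shows "gtp_act X Y A B \<phi> \<psi> (g, h) (pure_tensor X Y A B x y)
    = pure_tensor X Y A B (\<phi> g x) (\<psi> h y)"
  \<comment> \<open>A product element is the class of a one-element sequence, so the action can be
    computed on the representative \<open>[(x, y)]\<close>, which \<open>seq_act\<close> maps
    entrywise.\<close>
  using gtp_act_class[OF assms(1-6), of "[(x, y)]"] assms(7,8)
  by (simp add: pure_tensor_def gtp_seqs_def seq_act_def)

text \<open>The negated property is the one that transfers directly: it supplies factors
  \<open>x\<close> and \<open>y\<close>, and their images under \<open>g\<close> and
  \<open>h\<close> are factors of the new class.\<close>

lemma not_entangled_gtp_act:
  assumes act: "group_action G X \<phi>" "group_action H Y \<psi>"
    and eqv: "ops_equivariant G X A \<phi>" "ops_equivariant H Y B \<psi>"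
    and gh: "g \<in> carrier G" "h \<in> carrier H"
    and w: "\<not> entangled X Y A B w"
  shows "\<not> entangled X Y A B (gtp_act X Y A B \<phi> \<psi> (g, h) w)"
proof -
  obtain x y where xy: "x \<in> X" "y \<in> Y" and "w = pure_tensor X Y A B x y"
    using w by (auto simp: entangled_def)
  then have "gtp_act X Y A B \<phi> \<psi> (g, h) w = pure_tensor X Y A B (\<phi> g x) (\<psi> h y)"
    using gtp_act_pure_tensor[OF act eqv gh] by simp
  moreover have "\<phi> g x \<in> X" "\<psi> h y \<in> Y"
    using group_action.element_image[OF act(1) gh(1) xy(1)]
      group_action.element_image[OF act(2) gh(2) xy(2)] by auto
  ultimately show ?thesis
    by (auto simp: entangled_def)
qed

lemma entangled_gtp_act_iff:
  assumes act: "group_action G X \<phi>" "group_action H Y \<psi>"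
    and eqv: "ops_equivariant G X A \<phi>" "ops_equivariant H Y B \<psi>"
    and gh: "g \<in> carrier G" "h \<in> carrier H" and w: "w \<in> gtp X Y A B"
  shows "entangled X Y A B (gtp_act X Y A B \<phi> \<psi> (g, h) w) \<longleftrightarrow> entangled X Y A B w"
proof -
  have grp: "group G" "group H"
    using act by (auto simp: group_action_def group_hom_def)
  have "gtp_act X Y A B \<phi> \<psi> (inv\<^bsub>G\<^esub> g, inv\<^bsub>H\<^esub> h) (gtp_act X Y A B \<phi> \<psi> (g, h) w) = w"
    \<comment> \<open>Taking \<open>refl\<close> as the orbit equation makes its right-hand side the
      image of \<open>w\<close> itself; the inverse in \<open>G \<times>\<times> H\<close> is then
      computed componentwise.\<close>
    using group_action.orbit_sym_aux[OF group_action_gtp_act[OF act eqv] _ w refl, of "(g, h)"]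
      gh grp by simp
  moreover have "inv\<^bsub>G\<^esub> g \<in> carrier G" "inv\<^bsub>H\<^esub> h \<in> carrier H"
    using gh grp by simp_all
  ultimately show ?thesis
    \<comment> \<open>The first instance moves \<open>w\<close> by \<open>(g, h)\<close>; the second
      is left open for the inverse pair, which moves the image back to \<open>w\<close>.\<close>
    using not_entangled_gtp_act[OF act eqv gh] not_entangled_gtp_act[OF act eqv]
    by metis
qed

theorem theorem2p1:
  fixes X :: "'a set" and Y :: "'b set"
    and A :: "('a \<Rightarrow> 'a \<Rightarrow> 'a) set" and B :: "('b \<Rightarrow> 'b \<Rightarrow> 'b) set"
    and G :: "('g, 'm) monoid_scheme" and H :: "('h, 'n) monoid_scheme"
    and \<phi> :: "'g \<Rightarrow> 'a \<Rightarrow> 'a" and \<psi> :: "'h \<Rightarrow> 'b \<Rightarrow> 'b"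
  assumes "X \<noteq> {}" and "Y \<noteq> {}"
    and "A \<noteq> {}" and "binary_ops_on X A"
    and "B \<noteq> {}" and "binary_ops_on Y B"
    and "group_action G X \<phi>" and "group_action H Y \<psi>"
    and "ops_equivariant G X A \<phi>" and "ops_equivariant H Y B \<psi>"
  shows "\<forall>w \<in> gtp X Y A B. \<forall>(g, h) \<in> carrier (G \<times>\<times> H).
      (entangled X Y A B w \<longleftrightarrow> entangled X Y A B (gtp_act X Y A B \<phi> \<psi> (g, h) w)) \<and>
      (\<not> entangled X Y A B w \<longleftrightarrow> \<not> entangled X Y A B (gtp_act X Y A B \<phi> \<psi> (g, h) w))"
  \<comment> \<open>Both conjuncts are the same equivalence, the second with its two sides
    negated.\<close>
  using entangled_gtp_act_iff[OF assms(7-10)] by auto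

end
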